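(* Let $\Gamma=(V,E,r,s)$ be a finite directed graph, and let $H\Gamma=(V,E,r',s')$ be the hypergraph given by $r'(e)=\{r(e)\}$ and $s'(e)=\{s(e)\}$ for all $e\in E$. Then the graph $C^*$-algebra of $\Gamma$ and the hypergraph $C^*$-algebra of $H\Gamma$ are isomorphic: $C^*(\Gamma)\cong C^*(H\Gamma)$.
   Context: A finite directed graph $\Gamma=(V,E,r,s)$ consists of finite sets $V$ (vertices), $E$ (edges) and maps $r,s:E\to V$ (range and source); $v\in V$ is a sink if $s^{-1}(v)=\emptyset$. The graph $C^*$-algebra $C^*(\Gamma)$ is the universal $C^*$-algebra generated by mutually orthogonal projections $\tilde p_v$ ($v\in V$) and partial isometries $\tilde s_e$ ($e\in E$) such that: (CK1) $\tilde s_e^*\tilde s_f=\delta_{ef}\tilde p_{r(e)}$ for all $e,f\in E$; (CK2) $\tilde p_v=\sum_{e\in E,\,s(e)=v}\tilde s_e\tilde s_e^*$ for all $v\in V$ that are not sinks. A (finite directed) hypergraph $H\Gamma=(V,E,r,s)$ consists of finite sets $V$ (vertices) and $E$ (edges) and maps $r,s:E\to\mathcal P(V)\setminus\{\emptyset\}$ (range and source), where $\mathcal P(V)$ is the power set. A vertex $v$ is a sink if $v\notin s(e)$ for all $e\in E$. The hypergraph $C^*$-algebra $C^*(H\Gamma)$ is the universal $C^*$-algebra generated by mutually orthogonal projections $p_v$ ($v\in V$) and partial isometries $s_e$ ($e\in E$) such that: (HR1) $s_e^*s_f=\delta_{ef}\sum_{v\in r(e)}p_v$ for all $e,f\in E$;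 (HR2a) $s_es_e^*\le\sum_{v\in s(e)}p_v$ for all $e\in E$; (HR2b) $p_v\le\sum_{e\in E,\,v\in s(e)}s_es_e^*$ for all $v\in V$ that are not sinks. *)

theory Defs
  imports Complex_Main "HOL-Algebra.Ring" "Graph_Theory.Digraph"
begin

section \<open>C*-algebras\<close>

text \<open>
  C*-algebras need not be unital.  The record extends \<open>ring\<close> only in order to have the
  additive part of HOL-Algebra (\<open>abelian_group\<close>, \<open>finsum\<close>, subtraction) at hand; its
  field \<open>one\<close> carries no meaning and is subject to no axiom.
\<close>

record 'a cstar = "'a ring" +
  scale :: "complex \<Rightarrow> 'a \<Rightarrow> 'a"  (infixr "\<odot>\<index>" 75)
  adj :: "'a \<Rightarrow> 'a"  ("_\<^sup>\<star>\<index>" [1000] 999)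
  nrm :: "'a \<Rightarrow> real"

locale cstar_algebra = abelian_group A for A :: "('a, 'm) cstar_scheme" (structure) +
  assumes mult_closed: "\<lbrakk>x \<in> carrier A; y \<in> carrier A\<rbrakk> \<Longrightarrow> x \<otimes> y \<in> carrier A"
    and mult_assoc: "\<lbrakk>x \<in> carrier A; y \<in> carrier A; z \<in> carrier A\<rbrakk>
      \<Longrightarrow> (x \<otimes> y) \<otimes> z = x \<otimes> (y \<otimes> z)"
    and mult_add_left: "\<lbrakk>x \<in> carrier A; y \<in> carrier A; z \<in> carrier A\<rbrakk>
      \<Longrightarrow> (x \<oplus> y) \<otimes> z = x \<otimes> z \<oplus> y \<otimes> z"
    and mult_add_right: "\<lbrakk>x \<in> carrier A; y \<in> carrier A; z \<in> carrier A\<rbrakk>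
      \<Longrightarrow> x \<otimes> (y \<oplus> z) = x \<otimes> y \<oplus> x \<otimes> z"
    and scale_closed: "x \<in> carrier A \<Longrightarrow> c \<odot> x \<in> carrier A"
    and scale_one: "x \<in> carrier A \<Longrightarrow> 1 \<odot> x = x"
    and scale_scale: "x \<in> carrier A \<Longrightarrow> c \<odot> (d \<odot> x) = (c * d) \<odot> x"
    and scale_add_left: "x \<in> carrier A \<Longrightarrow> (c + d) \<odot> x = c \<odot> x \<oplus> d \<odot> x"
    and scale_add_right: "\<lbrakk>x \<in> carrier A; y \<in> carrier A\<rbrakk>
      \<Longrightarrow> c \<odot> (x \<oplus> y) = c \<odot> x \<oplus> c \<odot> y"
    and scale_mult_left: "\<lbrakk>x \<in> carrier A; y \<in> carrier A\<rbrakk>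
      \<Longrightarrow> (c \<odot> x) \<otimes> y = c \<odot> (x \<otimes> y)"
    and scale_mult_right: "\<lbrakk>x \<in> carrier A; y \<in> carrier A\<rbrakk>
      \<Longrightarrow> x \<otimes> (c \<odot> y) = c \<odot> (x \<otimes> y)"
    and adj_closed: "x \<in> carrier A \<Longrightarrow> x\<^sup>\<star> \<in> carrier A"
    and adj_adj: "x \<in> carrier A \<Longrightarrow> (x\<^sup>\<star>)\<^sup>\<star> = x"
    and adj_add: "\<lbrakk>x \<in> carrier A; y \<in> carrier A\<rbrakk> \<Longrightarrow> (x \<oplus> y)\<^sup>\<star> = x\<^sup>\<star> \<oplus> y\<^sup>\<star>"
    and adj_scale: "x \<in> carrier A \<Longrightarrow> (c \<odot> x)\<^sup>\<star> = cnj c \<odot> x\<^sup>\<star>"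
    and adj_mult: "\<lbrakk>x \<in> carrier A; y \<in> carrier A\<rbrakk> \<Longrightarrow> (x \<otimes> y)\<^sup>\<star> = y\<^sup>\<star> \<otimes> x\<^sup>\<star>"
    and nrm_nonneg: "x \<in> carrier A \<Longrightarrow> 0 \<le> nrm A x"
    and nrm_eq_zero_iff: "x \<in> carrier A \<Longrightarrow> nrm A x = 0 \<longleftrightarrow> x = \<zero>"
    and nrm_triangle: "\<lbrakk>x \<in> carrier A; y \<in> carrier A\<rbrakk>
      \<Longrightarrow> nrm A (x \<oplus> y) \<le> nrm A x + nrm A y"
    and nrm_scale: "x \<in> carrier A \<Longrightarrow> nrm A (c \<odot> x) = cmod c * nrm A x"
    and nrm_mult: "\<lbrakk>x \<in> carrier A; y \<in> carrier A\<rbrakk>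
      \<Longrightarrow> nrm A (x \<otimes> y) \<le> nrm A x * nrm A y"
    and cstar_identity: "x \<in> carrier A \<Longrightarrow> nrm A (x\<^sup>\<star> \<otimes> x) = (nrm A x)\<^sup>2"
    and complete: "\<lbrakk>\<And>n :: nat. X n \<in> carrier A;
        \<forall>e>0. \<exists>N. \<forall>m\<ge>N. \<forall>n\<ge>N. nrm A (X m \<ominus> X n) < e\<rbrakk>
      \<Longrightarrow> \<exists>L\<in>carrier A. (\<lambda>n. nrm A (X n \<ominus> L)) \<longlonglongrightarrow> 0"

definition star_hom :: "('a, 'm) cstar_scheme \<Rightarrow> ('b, 'n) cstar_scheme \<Rightarrow> ('a \<Rightarrow> 'b) set" where
  "star_hom A B = {h. h \<in> carrier A \<rightarrow> carrier B \<and>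
     (\<forall>x\<in>carrier A. \<forall>y\<in>carrier A. h (x \<oplus>\<^bsub>A\<^esub> y) = h x \<oplus>\<^bsub>B\<^esub> h y) \<and>
     (\<forall>x\<in>carrier A. \<forall>y\<in>carrier A. h (x \<otimes>\<^bsub>A\<^esub> y) = h x \<otimes>\<^bsub>B\<^esub> h y) \<and>
     (\<forall>c. \<forall>x\<in>carrier A. h (c \<odot>\<^bsub>A\<^esub> x) = c \<odot>\<^bsub>B\<^esub> h x) \<and>
     (\<forall>x\<in>carrier A. h (x\<^sup>\<star>\<^bsub>A\<^esub>) = (h x)\<^sup>\<star>\<^bsub>B\<^esub>)}"

definition cstar_isomorphic :: "('a, 'm) cstar_scheme \<Rightarrow> ('b, 'n) cstar_scheme \<Rightarrow> bool" where
  "cstar_isomorphic A B \<longleftrightarrow> (\<exists>h\<in>star_hom A B. bij_betw h (carrier A) (carrier B))"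

text \<open>The positive elements of a C*-algebra are those of the form \<open>c\<^sup>\<star> c\<close>.\<close>

definition cstar_le :: "('a, 'm) cstar_scheme \<Rightarrow> 'a \<Rightarrow> 'a \<Rightarrow> bool"  (infix "\<sqsubseteq>\<index>" 50) where
  "cstar_le A a b \<longleftrightarrow> a \<in> carrier A \<and> b \<in> carrier A \<and>
     (\<exists>c\<in>carrier A. b \<ominus>\<^bsub>A\<^esub> a = c\<^sup>\<star>\<^bsub>A\<^esub> \<otimes>\<^bsub>A\<^esub> c)"

definition projection :: "('a, 'm) cstar_scheme \<Rightarrow> 'a \<Rightarrow> bool" where
  "projection A p \<longleftrightarrow> p \<in> carrier A \<and> p\<^sup>\<star>\<^bsub>A\<^esub> = p \<and> p \<otimes>\<^bsub>A\<^esub> p = p"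

definition partial_isometry :: "('a, 'm) cstar_scheme \<Rightarrow> 'a \<Rightarrow> bool" where
  "partial_isometry A s \<longleftrightarrow> s \<in> carrier A \<and> s \<otimes>\<^bsub>A\<^esub> s\<^sup>\<star>\<^bsub>A\<^esub> \<otimes>\<^bsub>A\<^esub> s = s"


section \<open>Universal C*-algebras\<close>

text \<open>\<open>*\<close>-polynomials without constant term, as formal expressions in the generators.\<close>

datatype (gens: 'g) star_poly =
    Gen 'g
  | Zero
  | Add "'g star_poly" "'g star_poly"
  | Mult "'g star_poly" "'g star_poly"
  | Scale complex "'g star_poly"
  | Adj "'g star_poly"

primrec poly_eval :: "('a, 'm) cstar_scheme \<Rightarrow> ('g \<Rightarrow> 'a) \<Rightarrow> 'g star_poly \<Rightarrow> 'a" where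
  "poly_eval B f (Gen g) = f g"
| "poly_eval B f Zero = \<zero>\<^bsub>B\<^esub>"
| "poly_eval B f (Add t u) = poly_eval B f t \<oplus>\<^bsub>B\<^esub> poly_eval B f u"
| "poly_eval B f (Mult t u) = poly_eval B f t \<otimes>\<^bsub>B\<^esub> poly_eval B f u"
| "poly_eval B f (Scale c t) = c \<odot>\<^bsub>B\<^esub> poly_eval B f t"
| "poly_eval B f (Adj t) = (poly_eval B f t)\<^sup>\<star>\<^bsub>B\<^esub>"

text \<open>
  A representation of a set \<open>G\<close> of generators subject to relations \<open>R\<close> is a C*-algebra \<open>B\<close>
  together with a family \<open>f\<close> in \<open>B\<close> indexed by \<open>G\<close> that satisfies \<open>R\<close> in \<open>B\<close>.

  HOL cannot quantify over all C*-algebras of all types at once, so the elements of \<open>B\<close> are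
  taken from the type \<^typ>\<open>nat \<Rightarrow> 'g star_poly\<close>.  This loses nothing: if a C*-algebra is
  generated by a family indexed by \<open>G\<close>, each of its elements is the limit of a sequence of
  \<open>*\<close>-polynomials evaluated at the family, and choosing one such sequence for each element
  gives an isomorphic C*-algebra whose carrier is a set of sequences of \<open>*\<close>-polynomials.
\<close>

type_synonym 'g rep_elem = "nat \<Rightarrow> 'g star_poly"
type_synonym 'g rep = "'g rep_elem cstar \<times> ('g \<Rightarrow> 'g rep_elem)"
type_synonym 'g relations = "'g rep_elem cstar \<Rightarrow> ('g \<Rightarrow> 'g rep_elem) \<Rightarrow> bool"

definition reps :: "'g set \<Rightarrow> 'g relations \<Rightarrow> 'g rep set" where
  "reps G R = {(B, f). cstar_algebra B \<and> f \<in> G \<rightarrow> carrier B \<and> R B f}"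

text \<open>
  The universal C*-algebra is the completion of the \<open>*\<close>-polynomials in \<open>G\<close> with respect to
  the seminorm \<open>sup {\<parallel>\<pi>(t)\<parallel> | \<pi> a representation}\<close>.  It is realised as the closure, for
  the supremum norm, of the tuples \<open>(\<pi>(t))\<^sub>\<pi>\<close> inside the product of all representations \<open>\<pi>\<close>.
  The supremum is finite as soon as \<open>R\<close> bounds the norms of the generators, as relations
  demanding projections and partial isometries do.
\<close>

definition universal_cstar :: "'g set \<Rightarrow> 'g relations \<Rightarrow> ('g rep \<Rightarrow> 'g rep_elem) cstar" where
  "universal_cstar G R = \<lparr>
     carrier = {x \<in> extensional (reps G R).
       (\<forall>(B, f)\<in>reps G R. x (B, f) \<in> carrier B) \<and>
       (\<forall>e>0. \<exists>t. gens t \<subseteq> G \<and>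
          (\<forall>(B, f)\<in>reps G R. nrm B (x (B, f) \<ominus>\<^bsub>B\<^esub> poly_eval B f t) < e))},
     monoid.mult = (\<lambda>x y. \<lambda>\<pi>\<in>reps G R. x \<pi> \<otimes>\<^bsub>fst \<pi>\<^esub> y \<pi>),
     one = undefined,
     zero = (\<lambda>\<pi>\<in>reps G R. \<zero>\<^bsub>fst \<pi>\<^esub>),
     add = (\<lambda>x y. \<lambda>\<pi>\<in>reps G R. x \<pi> \<oplus>\<^bsub>fst \<pi>\<^esub> y \<pi>),
     scale = (\<lambda>c x. \<lambda>\<pi>\<in>reps G R. c \<odot>\<^bsub>fst \<pi>\<^esub> x \<pi>),
     adj = (\<lambda>x. \<lambda>\<pi>\<in>reps G R. (x \<pi>)\<^sup>\<star>\<^bsub>fst \<pi>\<^esub>),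
     nrm = (\<lambda>x. SUP \<pi>\<in>reps G R. nrm (fst \<pi>) (x \<pi>))\<rparr>"


section \<open>Graph C*-algebras\<close>

text \<open>
  A finite directed graph is a \<^locale>\<open>fin_digraph\<close>, with range map \<^const>\<open>head\<close> and source
  map \<^const>\<open>tail\<close>.
\<close>

definition graph_sink :: "('v, 'e) pre_digraph \<Rightarrow> 'v \<Rightarrow> bool" where
  "graph_sink \<Gamma> v \<longleftrightarrow> v \<in> verts \<Gamma> \<and> {e \<in> arcs \<Gamma>. tail \<Gamma> e = v} = {}"

definition orthogonal_projections :: "('a, 'm) cstar_scheme \<Rightarrow> 'v set \<Rightarrow> ('v \<Rightarrow> 'a) \<Rightarrow> bool" where
  "orthogonal_projections A V p \<longleftrightarrow> (\<forall>v\<in>V. projection A (p v)) \<and>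
     (\<forall>v\<in>V. \<forall>w\<in>V. v \<noteq> w \<longrightarrow> p v \<otimes>\<^bsub>A\<^esub> p w = \<zero>\<^bsub>A\<^esub>)"

definition cuntz_krieger_family ::
  "('v, 'e) pre_digraph \<Rightarrow> ('a, 'm) cstar_scheme \<Rightarrow> ('v \<Rightarrow> 'a) \<Rightarrow> ('e \<Rightarrow> 'a) \<Rightarrow> bool" where
  "cuntz_krieger_family \<Gamma> A p s \<longleftrightarrow>
     orthogonal_projections A (verts \<Gamma>) p \<and>
     (\<forall>e\<in>arcs \<Gamma>. partial_isometry A (s e)) \<and>
     (\<forall>e\<in>arcs \<Gamma>. \<forall>f\<in>arcs \<Gamma>.
        (s e)\<^sup>\<star>\<^bsub>A\<^esub> \<otimes>\<^bsub>A\<^esub> s f = (if e = f then p (head \<Gamma> e) else \<zero>\<^bsub>A\<^esub>)) \<and>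
     (\<forall>v\<in>verts \<Gamma>. \<not> graph_sink \<Gamma> v \<longrightarrow>
        p v = (\<Oplus>\<^bsub>A\<^esub>e\<in>{e \<in> arcs \<Gamma>. tail \<Gamma> e = v}. s e \<otimes>\<^bsub>A\<^esub> (s e)\<^sup>\<star>\<^bsub>A\<^esub>))"

definition graph_cstar_algebra ::
  "('v, 'e) pre_digraph \<Rightarrow> (('v + 'e) rep \<Rightarrow> ('v + 'e) rep_elem) cstar" where
  "graph_cstar_algebra \<Gamma> = universal_cstar (verts \<Gamma> <+> arcs \<Gamma>)
     (\<lambda>A f. cuntz_krieger_family \<Gamma> A (\<lambda>v. f (Inl v)) (\<lambda>e. f (Inr e)))"


section \<open>Hypergraph C*-algebras\<close>

record ('v, 'e) hypergraph =
  hverts :: "'v set"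
  hedges :: "'e set"
  hrange :: "'e \<Rightarrow> 'v set"
  hsource :: "'e \<Rightarrow> 'v set"

locale fin_hypergraph =
  fixes H :: "('v, 'e) hypergraph"
  assumes finite_hverts: "finite (hverts H)"
    and finite_hedges: "finite (hedges H)"
    and hrange_in: "e \<in> hedges H \<Longrightarrow> hrange H e \<in> Pow (hverts H) - {{}}"
    and hsource_in: "e \<in> hedges H \<Longrightarrow> hsource H e \<in> Pow (hverts H) - {{}}"

definition hypergraph_sink :: "('v, 'e) hypergraph \<Rightarrow> 'v \<Rightarrow> bool" where
  "hypergraph_sink H v \<longleftrightarrow> v \<in> hverts H \<and> (\<forall>e\<in>hedges H. v \<notin> hsource H e)"

definition hypergraph_family ::
  "('v, 'e) hypergraph \<Rightarrow> ('a, 'm) cstar_scheme \<Rightarrow> ('v \<Rightarrow> 'a) \<Rightarrow> ('e \<Rightarrow> 'a) \<Rightarrow> bool" where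
  "hypergraph_family H A p s \<longleftrightarrow>
     orthogonal_projections A (hverts H) p \<and>
     (\<forall>e\<in>hedges H. partial_isometry A (s e)) \<and>
     (\<forall>e\<in>hedges H. \<forall>f\<in>hedges H.
        (s e)\<^sup>\<star>\<^bsub>A\<^esub> \<otimes>\<^bsub>A\<^esub> s f = (if e = f then (\<Oplus>\<^bsub>A\<^esub>v\<in>hrange H e. p v) else \<zero>\<^bsub>A\<^esub>)) \<and>
     (\<forall>e\<in>hedges H. s e \<otimes>\<^bsub>A\<^esub> (s e)\<^sup>\<star>\<^bsub>A\<^esub> \<sqsubseteq>\<^bsub>A\<^esub> (\<Oplus>\<^bsub>A\<^esub>v\<in>hsource H e. p v)) \<and>
     (\<forall>v\<in>hverts H. \<not> hypergraph_sink H v \<longrightarrow>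
        p v \<sqsubseteq>\<^bsub>A\<^esub> (\<Oplus>\<^bsub>A\<^esub>e\<in>{e \<in> hedges H. v \<in> hsource H e}. s e \<otimes>\<^bsub>A\<^esub> (s e)\<^sup>\<star>\<^bsub>A\<^esub>))"

definition hypergraph_cstar_algebra ::
  "('v, 'e) hypergraph \<Rightarrow> (('v + 'e) rep \<Rightarrow> ('v + 'e) rep_elem) cstar" where
  "hypergraph_cstar_algebra H = universal_cstar (hverts H <+> hedges H)
     (\<lambda>A f. hypergraph_family H A (\<lambda>v. f (Inl v)) (\<lambda>e. f (Inr e)))"

definition digraph_hypergraph :: "('v, 'e) pre_digraph \<Rightarrow> ('v, 'e) hypergraph" where
  "digraph_hypergraph \<Gamma> = \<lparr>hverts = verts \<Gamma>, hedges = arcs \<Gamma>,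
     hrange = (\<lambda>e. {head \<Gamma> e}), hsource = (\<lambda>e. {tail \<Gamma> e})\<rparr>"

lemma (in fin_digraph) fin_hypergraph_digraph_hypergraph:
  "fin_hypergraph (digraph_hypergraph G)"
  by unfold_locales (auto simp: digraph_hypergraph_def)

end

theory Submission
  imports Defs "HOL-Computational_Algebra.Polynomial"
begin

text \<open>
  In any C*-algebra, the Cuntz-Krieger families of the graph are exactly the families of the
  hypergraph, so both universal algebras are built from the same representations.  That the
  hypergraph relations imply (CK2) rests on the fact that projections \<open>p \<le> q\<close> satisfy \<open>q p = p\<close>:
  if \<open>q - p = c\<^sup>\<star> c\<close>, then \<open>x = p - q p\<close> and \<open>y = c p\<close> satisfy \<open>x\<^sup>\<star> x + y\<^sup>\<star> y = 0\<close>, and this forces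
  \<open>x = y = 0\<close>.

  The last implication is proved without spectral theory.  With \<open>w = x y\<^sup>\<star>\<close>, the relation gives
  \<open>w\<^sup>\<star> w = - (y y\<^sup>\<star>)\<^sup>2\<close> and \<open>w w\<^sup>\<star> = - (x x\<^sup>\<star>)\<^sup>2\<close>, so the real and imaginary parts of \<open>w\<close> turn it
  into a vanishing sum of squares of self-adjoint elements, one of which is \<open>u = y y\<^sup>\<star>\<close>.  For
  self-adjoint \<open>u\<close> of norm less than 1, a polynomial approximation \<open>d\<close> of the square root of
  \<open>1 - u\<^sup>2\<close> makes \<open>d + \<i> u\<close> and \<open>d - \<i> u\<close> almost unitary, whence the norms of \<open>1 - u\<^sup>2\<close> and
  \<open>u - u\<^sup>3\<close> are at most 1 and 1/2.  The first bound makes squares positive in the sense that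
  \<open>T - u\<^sup>2\<close> has norm at most \<open>T\<close> for large \<open>T\<close>, a property inherited by sums.  If \<open>- u\<^sup>2\<close> is
  positive in this sense, then multiplication by \<open>1 - u\<^sup>2\<close> does not decrease norms, and the second
  bound yields \<open>\<parallel>u\<^sup>2\<parallel> \<le> \<parallel>u\<parallel> / 2\<close>, which fails for \<open>\<parallel>u\<parallel> = 3/4\<close>; the general case follows by scaling.
\<close>

text \<open>
  \<open>1 - sqrt_approx n\<close> approximates the square root of \<open>1 - X\<^sup>2\<close>: a fixed point \<open>r\<close> of the
  recursion satisfies \<open>(1 - r)\<^sup>2 = 1 - X\<^sup>2\<close>.
\<close>

primrec sqrt_approx :: "nat \<Rightarrow> complex poly" where
  "sqrt_approx 0 = 0"
| "sqrt_approx (Suc n) = smult (1/2) ([:0, 1:] * [:0, 1:] + sqrt_approx n * sqrt_approx n)"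

section \<open>Identities for the approximating polynomials\<close>

lemma smult_two: "smult 2 p = p + p" for p :: "complex poly"
  by (metis one_add_one smult_1_left smult_add_left)

text \<open>Identifies the error of the square root: with r the n-th approximant and r' the next, (1
  - r)^2 - (1 - X^2) = 2 (r' - r).\<close>

lemma double_sqrt_approx_Suc:
  "sqrt_approx (Suc n) + sqrt_approx (Suc n) = [:0, 1:] * [:0, 1:] + sqrt_approx n * sqrt_approx n"
  by (simp only: smult_two[symmetric]) simp

text \<open>The terms X^2 cancel and leave a difference of squares. If the approximants are bounded
  by R, each successive difference therefore shrinks by a factor R.\<close>

lemma sqrt_approx_diff:
  "sqrt_approx (Suc (Suc n)) - sqrt_approx (Suc n) =
   smult (1/2) ((sqrt_approx (Suc n) + sqrt_approx n) * (sqrt_approx (Suc n) - sqrt_approx n))"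
proof -
  have "smult (1/2) (x + p * p) - smult (1/2) (x + q * q) = smult (1/2) ((p + q) * (p - q))"
    for x p q :: "complex poly"
    by (simp only: smult_diff_right[symmetric]) (simp add: algebra_simps)
  from this[of "[:0, 1:] * [:0, 1:]" "sqrt_approx (Suc n)" "sqrt_approx n"] show ?thesis
    unfolding sqrt_approx.simps(2)[symmetric] .
qed

section \<open>Elementary consequences of the C*-algebra axioms\<close>

context cstar_algebra
begin

lemmas closed_simps [simp] = mult_closed scale_closed adj_closed

lemma add_self_eq_zeroD: "\<lbrakk>x \<in> carrier A; x \<oplus> x = x\<rbrakk> \<Longrightarrow> x = \<zero>"
  using add.l_cancel_one by blast

lemma scale_zero_left [simp]: "x \<in> carrier A \<Longrightarrow> 0 \<odot> x = \<zero>"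
  using scale_add_left[of x 0 0] by (intro add_self_eq_zeroD) auto

lemma scale_zero_right [simp]: "c \<odot> \<zero> = \<zero>"
  using scale_add_right[of \<zero> \<zero> c] by (intro add_self_eq_zeroD) auto

lemma mult_zero_left [simp]: "x \<in> carrier A \<Longrightarrow> \<zero> \<otimes> x = \<zero>"
  using mult_add_left[of \<zero> \<zero> x] by (intro add_self_eq_zeroD) auto

lemma mult_zero_right [simp]: "x \<in> carrier A \<Longrightarrow> x \<otimes> \<zero> = \<zero>"
  using mult_add_right[of x \<zero> \<zero>] by (intro add_self_eq_zeroD) auto

lemma adj_zero [simp]: "\<zero>\<^sup>\<star> = \<zero>"
  using adj_add[of \<zero> \<zero>] by (intro add_self_eq_zeroD) auto

lemma neg_eq_scale: "x \<in> carrier A \<Longrightarrow> \<ominus> x = (-1) \<odot> x"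
  using scale_add_left[of x "-1" 1] by (intro minus_equality) (auto simp: scale_one)

lemma minus_eq_scale: "\<lbrakk>x \<in> carrier A; y \<in> carrier A\<rbrakk> \<Longrightarrow> x \<ominus> y = x \<oplus> (-1) \<odot> y"
  by (simp add: a_minus_def neg_eq_scale)

lemma add_scale_minus_one: "x \<in> carrier A \<Longrightarrow> x \<oplus> (-1) \<odot> x = \<zero>"
  using r_neg[of x] by (simp add: neg_eq_scale)

lemma mult_minus_left: "\<lbrakk>x \<in> carrier A; y \<in> carrier A; z \<in> carrier A\<rbrakk> \<Longrightarrow> (x \<ominus> y) \<otimes> z = x \<otimes> z \<ominus> y \<otimes> z"
  by (simp add: minus_eq_scale mult_add_left scale_mult_left)

lemma mult_minus_right: "\<lbrakk>x \<in> carrier A; y \<in> carrier A; z \<in> carrier A\<rbrakk> \<Longrightarrow> x \<otimes> (y \<ominus> z) = x \<otimes> y \<ominus> x \<otimes> z"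
  by (simp add: minus_eq_scale mult_add_right scale_mult_right)

lemma adj_minus: "\<lbrakk>x \<in> carrier A; y \<in> carrier A\<rbrakk> \<Longrightarrow> (x \<ominus> y)\<^sup>\<star> = x\<^sup>\<star> \<ominus> y\<^sup>\<star>"
  by (simp add: minus_eq_scale adj_add adj_scale)

lemma minus_self [simp]: "x \<in> carrier A \<Longrightarrow> x \<ominus> x = \<zero>"
  by (simp add: a_minus_def r_neg)

lemma eq_of_minus_eq_zero: "\<lbrakk>x \<in> carrier A; y \<in> carrier A; x \<ominus> y = \<zero>\<rbrakk> \<Longrightarrow> x = y"
  by (metis a_minus_def add.inv_closed add.inv_equality minus_minus)

lemma nrm_zero [simp]: "nrm A \<zero> = 0"
  by (simp add: nrm_eq_zero_iff)

text \<open>The C*-identity and submultiplicativity give ||x||^2 <= ||x*|| ||x||, and a nonzero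
  ||x|| cancels.\<close>

lemma nrm_adj_le: assumes x: "x \<in> carrier A" shows "nrm A x \<le> nrm A (x\<^sup>\<star>)"
proof (cases "nrm A x = 0")
  case False
  then have pos: "nrm A x > 0" using nrm_nonneg[OF x] by simp
  have "nrm A x * nrm A x \<le> nrm A (x\<^sup>\<star>) * nrm A x"
    using nrm_mult[of "x\<^sup>\<star>" x] cstar_identity[OF x] x by (simp add: power2_eq_square)
  with pos show ?thesis by simp
qed (use x in \<open>simp add: nrm_nonneg\<close>)

lemma nrm_adj: "x \<in> carrier A \<Longrightarrow> nrm A (x\<^sup>\<star>) = nrm A x"
  using nrm_adj_le[of x] nrm_adj_le[of "x\<^sup>\<star>"] by (simp add: adj_adj)

section \<open>Polynomials acting by left multiplication\<close>

text \<open>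
  Letting polynomials in \<open>u\<close> act on \<open>A\<close> by left multiplication replaces the missing unit, and
  moves the algebra to the commutative ring of complex polynomials.
\<close>

definition poly_act :: "'a \<Rightarrow> complex poly \<Rightarrow> 'a \<Rightarrow> 'a" where
  "poly_act u P b = fold_coeffs (\<lambda>c y. c \<odot> b \<oplus> u \<otimes> y) P \<zero>"

context
  fixes u
  assumes u: "u \<in> carrier A"
begin

lemma poly_act_0 [simp]: "poly_act u 0 b = \<zero>"
  by (simp add: poly_act_def)

lemma poly_act_pCons: 
  "b \<in> carrier A \<Longrightarrow> poly_act u (pCons c P) b = c \<odot> b \<oplus> u \<otimes> poly_act u P b"
  \<comment> \<open>\<open>fold_coeffs\<close> skips the zero polynomial, so the recursion is
    checked separately for \<open>pCons 0 0\<close>.\<close>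
  using u by (cases "c = 0 \<and> P = 0") (auto simp: poly_act_def)

lemma poly_act_closed [simp]: "b \<in> carrier A \<Longrightarrow> poly_act u P b \<in> carrier A"
  using u by (induction P) (auto simp: poly_act_pCons)

lemma poly_act_const [simp]: "b \<in> carrier A \<Longrightarrow> poly_act u [:c:] b = c \<odot> b"
  using u by (simp add: poly_act_pCons)

lemma poly_act_X [simp]: "b \<in> carrier A \<Longrightarrow> poly_act u [:0, 1:] b = u \<otimes> b"
  using u by (simp add: poly_act_pCons scale_one)

lemma poly_act_add: "b \<in> carrier A \<Longrightarrow> poly_act u (P + Q) b = poly_act u P b \<oplus> poly_act u Q b"
proof (induction P Q rule: poly_induct2)
  case (pCons c P d Q)
  then show ?case using u by (simp add: poly_act_pCons scale_add_left mult_add_right a_ac)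
qed simp

lemma poly_act_smult: "b \<in> carrier A \<Longrightarrow> poly_act u (smult c P) b = c \<odot> poly_act u P b"
proof (induction P)
  case (pCons d P)
  then show ?case using u
    by (simp add: poly_act_pCons scale_scale scale_add_right scale_mult_right)
qed simp

lemma poly_act_mult: "b \<in> carrier A \<Longrightarrow> poly_act u (P * Q) b = poly_act u P (poly_act u Q b)"
proof (induction P)
  case (pCons c P)
  then show ?case using u by (simp add: poly_act_add poly_act_smult poly_act_pCons)
qed simp

section \<open>Operator bounds and adjoints for the action\<close>

text \<open>\<open>K\<close> bounds the operator norm of \<open>P\<close> evaluated at
  \<open>u\<close>. In the zero algebra the inequality alone would not force
  \<open>0 \<le> K\<close>, which products and limits of bounds rely on.\<close>

definition act_bound :: "complex poly \<Rightarrow> real \<Rightarrow> bool" where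
  "act_bound P K \<longleftrightarrow> 0 \<le> K \<and> (\<forall>b\<in>carrier A. nrm A (poly_act u P b) \<le> K * nrm A b)"

lemma act_bound_add: "\<lbrakk>act_bound P K; act_bound Q L\<rbrakk> \<Longrightarrow> act_bound (P + Q) (K + L)"
  unfolding act_bound_def
  by (auto simp: poly_act_add algebra_simps intro!: order_trans[OF nrm_triangle] add_mono)

lemma act_bound_mult: "\<lbrakk>act_bound P K; act_bound Q L\<rbrakk> \<Longrightarrow> act_bound (P * Q) (K * L)"
  unfolding act_bound_def
proof (intro conjI ballI)
  assume P: "0 \<le> K \<and> (\<forall>b\<in>carrier A. nrm A (poly_act u P b) \<le> K * nrm A b)"
    and Q: "0 \<le> L \<and> (\<forall>b\<in>carrier A. nrm A (poly_act u Q b) \<le> L * nrm A b)"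
  then show "0 \<le> K * L" by simp
  fix b assume b: "b \<in> carrier A"
  then have "nrm A (poly_act u (P * Q) b) \<le> K * nrm A (poly_act u Q b)"
    using P by (simp add: poly_act_mult)
  also have "\<dots> \<le> K * (L * nrm A b)" using P Q b by (intro mult_left_mono) auto
  finally show "nrm A (poly_act u (P * Q) b) \<le> K * L * nrm A b" by (simp add: mult.assoc)
qed

lemma act_bound_const: "act_bound [:c:] (cmod c)"
  by (simp add: act_bound_def nrm_scale)

lemma act_bound_X: "act_bound [:0, 1:] (nrm A u)"
  using u by (simp add: act_bound_def nrm_mult nrm_nonneg)

lemma act_bound_mono: "\<lbrakk>act_bound P K; K \<le> L\<rbrakk> \<Longrightarrow> act_bound P L"
  unfolding act_bound_def by (meson mult_right_mono nrm_nonneg order_trans)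

lemma act_bound_smult: "act_bound P K \<Longrightarrow> act_bound (smult c P) (cmod c * K)"
  using act_bound_mult[OF act_bound_const[of c]] by simp

lemma act_bound_diff: "\<lbrakk>act_bound P K; act_bound Q L\<rbrakk> \<Longrightarrow> act_bound (P - Q) (K + L)"
  using act_bound_add[OF _ act_bound_smult[of Q L "-1"]] by simp

text \<open>This avoids constructing a square root: the bounds have to converge, not the
  approximants.\<close>

lemma act_bound_limit:
  assumes "\<And>n :: nat. act_bound P (K n)" and lim: "K \<longlonglongrightarrow> L"
  shows "act_bound P L"
  unfolding act_bound_def
proof (intro conjI ballI)
  show "0 \<le> L" using assms by (auto simp: act_bound_def intro: LIMSEQ_le_const)
  fix b assume "b \<in> carrier A"
  then show "nrm A (poly_act u P b) \<le> L * nrm A b"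
    using assms by (auto simp: act_bound_def intro!: LIMSEQ_le_const[OF tendsto_mult_right[OF lim]])
qed

text \<open>\<open>Q\<close> is the adjoint of \<open>P\<close> for the algebra-valued inner product
  that sends b and c to b* c.\<close>

definition adjoint_polys :: "complex poly \<Rightarrow> complex poly \<Rightarrow> bool" where
  "adjoint_polys P Q \<longleftrightarrow>
     (\<forall>b\<in>carrier A. \<forall>c\<in>carrier A. (poly_act u P b)\<^sup>\<star> \<otimes> c = b\<^sup>\<star> \<otimes> poly_act u Q c)"

lemma adjoint_polys_add:
  "\<lbrakk>adjoint_polys P P'; adjoint_polys Q Q'\<rbrakk> \<Longrightarrow> adjoint_polys (P + Q) (P' + Q')"
  unfolding adjoint_polys_def by (auto simp: poly_act_add adj_add mult_add_left mult_add_right)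

text \<open>Taking adjoints reverses the factors, and commutativity of polynomials restores their
  order.\<close>

lemma adjoint_polys_mult:
  "\<lbrakk>adjoint_polys P P'; adjoint_polys Q Q'\<rbrakk> \<Longrightarrow> adjoint_polys (P * Q) (P' * Q')"
  unfolding adjoint_polys_def by (simp add: poly_act_mult mult.commute[of P'])

lemma adjoint_polys_const: "adjoint_polys [:c:] [:cnj c:]"
  by (simp add: adjoint_polys_def adj_scale scale_mult_left scale_mult_right)

text \<open>The C*-identity at c = P b turns ||c||^2 into the norm of b* (Q P b), which is at most
  K^2 ||b||^2.\<close>

lemma act_bound_cstar:
  assumes adj: "adjoint_polys P Q" and bd: "act_bound (Q * P) (K\<^sup>2)" and K: "0 \<le> K"
  shows "act_bound P K"
  unfolding act_bound_def
proof (intro conjI ballI)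
  fix b assume b: "b \<in> carrier A"
  let ?c = "poly_act u P b"
  have "(nrm A ?c)\<^sup>2 = nrm A (b\<^sup>\<star> \<otimes> poly_act u (Q * P) b)"
    using adj b cstar_identity[of ?c] by (simp add: adjoint_polys_def poly_act_mult)
  also have "\<dots> \<le> nrm A b * nrm A (poly_act u (Q * P) b)"
    using nrm_mult[of "b\<^sup>\<star>"] b by (simp add: nrm_adj)
  also have "\<dots> \<le> nrm A b * (K\<^sup>2 * nrm A b)"
    using b bd by (intro mult_left_mono) (auto simp: act_bound_def nrm_nonneg)
  finally have "(nrm A ?c)\<^sup>2 \<le> (K * nrm A b)\<^sup>2" by (simp add: power2_eq_square algebra_simps)
  then show "nrm A ?c \<le> K * nrm A b"
    by (rule power2_le_imp_le) (simp add: K b nrm_nonneg)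
qed (fact K)

section \<open>Norm estimates for a self-adjoint element of norm below 1\<close>

context
  assumes sa: "u\<^sup>\<star> = u" and lt1: "nrm A u < 1"
begin

lemma adjoint_polys_X: "adjoint_polys [:0, 1:] [:0, 1:]"
  using u sa by (simp add: adjoint_polys_def adj_mult mult_assoc)

lemma adjoint_polys_sqrt_approx: "adjoint_polys (sqrt_approx n) (sqrt_approx n)"
proof (induction n)
  case 0
  then show ?case using adjoint_polys_const[of 0] by simp
next
  case (Suc n)
  then show ?case
    using adjoint_polys_mult[OF adjoint_polys_const[of "1/2"]
        adjoint_polys_add[OF adjoint_polys_mult[OF adjoint_polys_X adjoint_polys_X]
          adjoint_polys_mult[OF Suc Suc]]] by simp
qed

text \<open>All approximants are bounded by one R < 1, so the difference formula contracts by (R +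
  R) / 2 = R at each step.\<close>

lemma sqrt_approx_bounds:
  obtains R where "0 \<le> R" "R < 1" "\<And>n. act_bound (sqrt_approx (Suc n) - sqrt_approx n) (R ^ Suc n)"
proof -
  let ?\<rho> = "nrm A u"
  \<comment> \<open>The smaller fixed point of R = (\<rho>^2 + R^2) / 2, the scalar form of the
    recursion.\<close>
  define R where "R = 1 - sqrt (1 - ?\<rho>\<^sup>2)"
  have \<rho>: "0 \<le> ?\<rho>" using u by (simp add: nrm_nonneg)
  then have \<rho>2: "?\<rho>\<^sup>2 < 1" using lt1 by (simp add: power_less_one_iff)
  have R0: "0 \<le> R" unfolding R_def by simp
  have R1: "R < 1" unfolding R_def using \<rho>2 by simp
  have "(1 - R)\<^sup>2 = 1 - ?\<rho>\<^sup>2" unfolding R_def using \<rho>2 by simp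
  then have fix_R: "?\<rho> * ?\<rho> + R * R = 2 * R" by (simp add: power2_eq_square algebra_simps)
  have XX: "act_bound ([:0, 1:] * [:0, 1:]) (?\<rho> * ?\<rho>)"
    by (intro act_bound_mult act_bound_X)
  have r: "act_bound (sqrt_approx n) R" for n
  proof (induction n)
    case 0
    then show ?case using R0 by (simp add: act_bound_def nrm_nonneg)
  next
    case (Suc n)
    show ?case
      using act_bound_smult[OF act_bound_add[OF XX act_bound_mult[OF Suc Suc]], of "1/2"]
      by (simp add: fix_R)
  qed
  have "act_bound (sqrt_approx (Suc n) - sqrt_approx n) (R ^ Suc n)" for n
  proof (induction n)
    case 0
    then show ?case using r[of 1] by simp
  next
    case (Suc n)
    have "act_bound (sqrt_approx (Suc (Suc n)) - sqrt_approx (Suc n))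
        (cmod (1/2) * ((R + R) * R ^ Suc n))"
      unfolding sqrt_approx_diff by (intro act_bound_smult act_bound_mult act_bound_add r Suc)
    then show ?case by simp
  qed
  with R0 R1 show thesis by (rule that)
qed

text \<open>Averaging the almost unitary d + \<i> X and d - \<i> X bounds d by about 1; the
  difference of their squares is 4 \<i> d X and bounds d X by about 1/2. Then 1 - X^2 = d^2 - e and
  X - X^3 = d (d X) - e X give both claims in the limit.\<close>

lemma
  shows act_bound_one_minus_square: "act_bound (1 - [:0, 1:] * [:0, 1:]) 1"
    and act_bound_minus_cube: "act_bound ([:0, 1:] - [:0, 1:] * [:0, 1:] * [:0, 1:]) (1/2)"
proof -
  let ?X = "[:0, 1:] :: complex poly"
  obtain R where R: "0 \<le> R" "R < 1"
      "\<And>n. act_bound (sqrt_approx (Suc n) - sqrt_approx n) (R ^ Suc n)"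
    using sqrt_approx_bounds by blast
  define \<eta> where "\<eta> n = 2 * R ^ Suc n" for n
  have \<eta>: "0 \<le> \<eta> n" for n using R by (simp add: \<eta>_def)
  have lim: "\<eta> \<longlonglongrightarrow> 0"
    unfolding \<eta>_def using R
    by (intro tendsto_mult_right_zero LIMSEQ_Suc LIMSEQ_power_zero) auto
  define d where "d n = 1 - sqrt_approx n" for n
  define e where "e n = d n * d n - (1 - ?X * ?X)" for n
  have e: "act_bound (e n) (\<eta> n)" for n
  proof -
    have "(1 - r) * (1 - r) - (1 - x) = (x + r * r) - (r + r)" for x r :: "complex poly"
      by (simp add: algebra_simps)
    then have "e n = (sqrt_approx (Suc n) + sqrt_approx (Suc n)) - (sqrt_approx n + sqrt_approx n)"
      unfolding double_sqrt_approx_Suc e_def d_def .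
    also have "\<dots> = smult 2 (sqrt_approx (Suc n) - sqrt_approx n)"
      unfolding smult_two by simp
    finally show ?thesis
      using act_bound_smult[OF R(3)[of n], of 2] by (simp add: \<eta>_def)
  qed
  have one: "act_bound 1 1" using act_bound_const[of 1] by (simp add: pCons_one)
  have d_adj: "adjoint_polys (d n) (d n)" for n
    using adjoint_polys_add[OF adjoint_polys_const[of 1]
        adjoint_polys_mult[OF adjoint_polys_const[of "-1"] adjoint_polys_sqrt_approx[of n]]]
    by (simp add: d_def pCons_one)
  \<comment> \<open>The C*-identity applies to \<open>(d - \<i> X) (d + \<i> X) = d\<^sup>2 + X\<^sup>2 = 1 + e\<close>.\<close>
  have W: "act_bound (d n + [:z:] * ?X) (1 + \<eta> n)" if z: "z = \<i> \<or> z = -\<i>" for z n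
  proof (rule act_bound_cstar)
    show "adjoint_polys (d n + [:z:] * ?X) (d n + [:cnj z:] * ?X)"
      by (intro adjoint_polys_add adjoint_polys_mult adjoint_polys_const adjoint_polys_X d_adj)
    have zz: "[:z:] + [:cnj z:] = 0" "[:z:] * [:cnj z:] = 1" using z by (auto simp: pCons_one)
    have "(d + j * x) * (d + i * x) = d * d + (i + j) * (d * x) + (i * j) * (x * x)"
      for d i j x :: "complex poly" by (simp add: algebra_simps)
    then have "(d n + [:cnj z:] * ?X) * (d n + [:z:] * ?X)
        = d n * d n + ([:z:] + [:cnj z:]) * (d n * ?X) + ([:z:] * [:cnj z:]) * (?X * ?X)" .
    also have "\<dots> = 1 + e n" unfolding zz by (simp add: e_def)
    finally have "act_bound ((d n + [:cnj z:] * ?X) * (d n + [:z:] * ?X)) (1 + \<eta> n)"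
      using act_bound_add[OF one e] by simp
    \<comment> \<open>\<open>act_bound_cstar\<close> asks for a squared bound, and 1 + \<eta> <= (1
      + \<eta>)^2.\<close>
    then show "act_bound ((d n + [:cnj z:] * ?X) * (d n + [:z:] * ?X)) ((1 + \<eta> n)\<^sup>2)"
      by (rule act_bound_mono) (use \<eta>[of n] in \<open>simp add: power2_eq_square algebra_simps\<close>)
  qed (use \<eta>[of n] in simp)
  have d: "act_bound (d n) (1 + \<eta> n)" for n
  proof -
    have "(d n + [:\<i>:] * ?X) + (d n + [:-\<i>:] * ?X) = smult 2 (d n)"
      unfolding smult_two by simp
    then show ?thesis
      using act_bound_smult[OF act_bound_add[OF W[of \<i> n] W[of "-\<i>" n]], of "1/2"]
      by (simp add: add_divide_distrib)
  qed
  have dX: "act_bound (d n * ?X) ((1 + \<eta> n) * (1 + \<eta> n) / 2)" for n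
  proof -
    \<comment> \<open>Since \<i> and -\<i> have the same square, only the mixed term d X
      survives.\<close>
    have "(d + i * x) * (d + i * x) - (d + j * x) * (d + j * x)
        = (i * i - j * j) * (x * x) + (i + i - j - j) * (d * x)" for d i j x :: "complex poly"
      by (simp add: algebra_simps)
    then have "(d n + [:\<i>:] * ?X) * (d n + [:\<i>:] * ?X) - (d n + [:-\<i>:] * ?X) * (d n + [:-\<i>:] * ?X)
        = ([:\<i>:] * [:\<i>:] - [:-\<i>:] * [:-\<i>:]) * (?X * ?X)
          + ([:\<i>:] + [:\<i>:] - [:-\<i>:] - [:-\<i>:]) * (d n * ?X)" .
    also have "\<dots> = smult (4 * \<i>) (d n * ?X)" by simp
    finally show ?thesis
      using act_bound_smult[OF act_bound_diff[OF act_bound_mult[OF W[of \<i> n] W[of \<i> n]]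
            act_bound_mult[OF W[of "-\<i>" n] W[of "-\<i>" n]]], of "1 / (4 * \<i>)"]
      by (simp add: norm_divide norm_mult)
  qed
  show "act_bound (1 - ?X * ?X) 1"
  proof (rule act_bound_limit)
    have "1 - ?X * ?X = d n * d n - e n" for n by (simp add: e_def)
    then show "act_bound (1 - ?X * ?X) ((1 + \<eta> n) * (1 + \<eta> n) + \<eta> n)" for n
      by (metis act_bound_diff act_bound_mult d e)
    show "(\<lambda>n. (1 + \<eta> n) * (1 + \<eta> n) + \<eta> n) \<longlonglongrightarrow> 1"
      using tendsto_add[OF tendsto_mult[OF tendsto_add[OF tendsto_const[of 1] lim]
            tendsto_add[OF tendsto_const[of 1] lim]] lim] by simp
  qed
  show "act_bound (?X - ?X * ?X * ?X) (1/2)"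
  proof (rule act_bound_limit)
    have "x - x * x * x = d * (d * x) - (d * d - (1 - x * x)) * x" for d x :: "complex poly"
      by (simp add: algebra_simps)
    then have "?X - ?X * ?X * ?X = d n * (d n * ?X) - e n * ?X" for n
      unfolding e_def .
    then show "act_bound (?X - ?X * ?X * ?X)
        ((1 + \<eta> n) * ((1 + \<eta> n) * (1 + \<eta> n) / 2) + \<eta> n * nrm A u)" for n
      by (metis act_bound_diff act_bound_mult act_bound_X d dX e)
    have "(\<lambda>n. (1 + \<eta> n) * ((1 + \<eta> n) * (1 + \<eta> n) / 2) + \<eta> n * nrm A u)
        \<longlonglongrightarrow> (1 + 0) * ((1 + 0) * (1 + 0) / 2) + 0 * nrm A u"
      by (intro tendsto_intros lim) auto
    then show "(\<lambda>n. (1 + \<eta> n) * ((1 + \<eta> n) * (1 + \<eta> n) / 2) + \<eta> n * nrm A u) \<longlonglongrightarrow> 1/2"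
      by simp
  qed
qed

lemma nrm_minus_square_le:
  assumes b: "b \<in> carrier A"
  shows "nrm A (b \<ominus> u \<otimes> (u \<otimes> b)) \<le> nrm A b"
proof -
  have "1 - [:0, 1:] * [:0, 1:] = [:1:] + [:-1:] * ([:0, 1:] * [:0, 1:] :: complex poly)"
    by (simp add: one_pCons)
  then have "poly_act u (1 - [:0, 1:] * [:0, 1:]) b = b \<ominus> u \<otimes> (u \<otimes> b)"
    using u b by (simp only: poly_act_add poly_act_mult poly_act_X poly_act_const
        closed_simps scale_one minus_eq_scale)
  then show ?thesis
    using act_bound_one_minus_square b by (fastforce simp: act_bound_def)
qed

lemma nrm_minus_cube_le:
  assumes b: "b \<in> carrier A"
  shows "nrm A (u \<otimes> b \<ominus> u \<otimes> (u \<otimes> (u \<otimes> b))) \<le> nrm A b / 2"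
proof -
  have "[:0, 1:] - [:0, 1:] * [:0, 1:] * [:0, 1:]
      = [:0, 1:] + [:-1:] * ([:0, 1:] * [:0, 1:] * [:0, 1:] :: complex poly)" by simp
  then have "poly_act u ([:0, 1:] - [:0, 1:] * [:0, 1:] * [:0, 1:]) b
      = u \<otimes> b \<ominus> u \<otimes> (u \<otimes> (u \<otimes> b))"
    using u b by (simp only: poly_act_add poly_act_mult poly_act_X poly_act_const
        closed_simps minus_eq_scale)
  then show ?thesis
    using act_bound_minus_cube b by (fastforce simp: act_bound_def)
qed

end

end

section \<open>Positivity expressed through norms\<close>

text \<open>Positivity of \<open>x\<close>, expressed as \<open>\<parallel>T - x\<parallel> \<le> T\<close> for some \<open>T\<close>, again without using a unit.\<close>

definition norm_positive :: "'a \<Rightarrow> bool" where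
  "norm_positive x \<longleftrightarrow> x \<in> carrier A \<and>
     (\<exists>T\<ge>0. \<forall>b\<in>carrier A. nrm A (complex_of_real T \<odot> b \<ominus> x \<otimes> b) \<le> T * nrm A b)"

text \<open>The constants add up, by the triangle inequality.\<close>

lemma norm_positive_add:
  assumes "norm_positive x" "norm_positive y"
  shows "norm_positive (x \<oplus> y)"
proof -
  obtain S T where S: "S \<ge> 0" "\<And>b. b \<in> carrier A \<Longrightarrow> nrm A (complex_of_real S \<odot> b \<ominus> x \<otimes> b) \<le> S * nrm A b"
    and T: "T \<ge> 0" "\<And>b. b \<in> carrier A \<Longrightarrow> nrm A (complex_of_real T \<odot> b \<ominus> y \<otimes> b) \<le> T * nrm A b"
    using assms by (auto simp: norm_positive_def)
  have xy: "x \<in> carrier A" "y \<in> carrier A" using assms by (auto simp: norm_positive_def)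
  have "nrm A (complex_of_real (S + T) \<odot> b \<ominus> (x \<oplus> y) \<otimes> b) \<le> (S + T) * nrm A b"
    if b: "b \<in> carrier A" for b
  proof -
    have "complex_of_real (S + T) \<odot> b \<ominus> (x \<oplus> y) \<otimes> b
        = (complex_of_real S \<odot> b \<ominus> x \<otimes> b) \<oplus> (complex_of_real T \<odot> b \<ominus> y \<otimes> b)"
      using xy b
      by (simp add: minus_eq_scale mult_add_left scale_add_left scale_add_right a_ac)
    then show ?thesis
      using nrm_triangle[of "complex_of_real S \<odot> b \<ominus> x \<otimes> b" "complex_of_real T \<odot> b \<ominus> y \<otimes> b"]
        S(2)[OF b] T(2)[OF b] xy b by (simp add: algebra_simps)
  qed
  then show ?thesis
    using xy S(1) T(1) unfolding norm_positive_def
    by (intro conjI exI[of _ "S + T"]) auto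
qed

lemma norm_positive_scale:
  assumes "norm_positive x" and c: "0 \<le> c"
  shows "norm_positive (complex_of_real c \<odot> x)"
proof -
  obtain T where T: "T \<ge> 0" "\<And>b. b \<in> carrier A \<Longrightarrow> nrm A (complex_of_real T \<odot> b \<ominus> x \<otimes> b) \<le> T * nrm A b"
    using assms by (auto simp: norm_positive_def)
  have x: "x \<in> carrier A" using assms by (auto simp: norm_positive_def)
  have "nrm A (complex_of_real (c * T) \<odot> b \<ominus> (complex_of_real c \<odot> x) \<otimes> b) \<le> c * T * nrm A b"
    if b: "b \<in> carrier A" for b
  proof -
    have "complex_of_real (c * T) \<odot> b \<ominus> (complex_of_real c \<odot> x) \<otimes> b
        = complex_of_real c \<odot> (complex_of_real T \<odot> b \<ominus> x \<otimes> b)"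
      using x b by (simp add: minus_eq_scale scale_mult_left scale_add_right scale_scale mult.commute)
    then show ?thesis
      using T(2)[OF b] c x b by (simp add: nrm_scale mult_left_mono mult.assoc)
  qed
  then show ?thesis
    using x T(1) c unfolding norm_positive_def
    by (intro conjI exI[of _ "c * T"]) auto
qed

text \<open>After scaling \<open>u\<close> to norm below 1, \<open>nrm_minus_square_le\<close>
  provides the constant T = 1.\<close>

lemma norm_positive_square:
  assumes u: "u \<in> carrier A" and sa: "u\<^sup>\<star> = u"
  shows "norm_positive (u \<otimes> u)"
proof -
  define s where "s = nrm A u + 1"
  have s: "s > 0" using nrm_nonneg[OF u] by (simp add: s_def)
  define v where "v = complex_of_real (1 / s) \<odot> u"
  have v: "v \<in> carrier A" "v\<^sup>\<star> = v" using u sa by (simp_all add: v_def adj_scale)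
  have "nrm A v = nrm A u / s" using u s by (simp add: v_def nrm_scale norm_divide)
  then have lt1: "nrm A v < 1" using s by (simp add: s_def)
  have v_sq: "v \<otimes> v = complex_of_real ((1 / s)\<^sup>2) \<odot> (u \<otimes> u)"
    using u by (simp add: v_def scale_mult_left scale_mult_right scale_scale power2_eq_square)
  have "norm_positive (v \<otimes> v)"
    using nrm_minus_square_le[OF v(1) v(2) lt1] v(1) unfolding norm_positive_def
    by (auto simp: mult_assoc scale_one intro!: exI[of _ 1])
  then have "norm_positive (complex_of_real (s\<^sup>2) \<odot> (v \<otimes> v))"
    by (rule norm_positive_scale) simp
  moreover have "complex_of_real (s\<^sup>2) \<odot> (v \<otimes> v) = u \<otimes> u"
    using s u by (simp add: v_sq scale_scale power_divide scale_one)
  ultimately show ?thesis by simp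
qed

lemma norm_positive_minus_square_imp_zero:
  assumes u: "u \<in> carrier A" and sa: "u\<^sup>\<star> = u" and neg: "norm_positive ((-1) \<odot> (u \<otimes> u))"
  shows "u = \<zero>"
proof (rule ccontr)
  assume "u \<noteq> \<zero>"
  then have pos: "nrm A u > 0" using u nrm_nonneg[OF u] nrm_eq_zero_iff[OF u] by auto
  \<comment> \<open>The scaled \<open>v\<close> has norm 3/4: below 1, so the cube estimate applies,
    and above 1/2, so ||v||^2 <= ||v|| / 2 is absurd.\<close>
  define t where "t = 3 / (4 * nrm A u)"
  have t: "t > 0" using pos by (simp add: t_def)
  define v where "v = complex_of_real t \<odot> u"
  have v: "v \<in> carrier A" "v\<^sup>\<star> = v" using u sa by (simp_all add: v_def adj_scale)
  have nv: "nrm A v = 3 / 4" using u t pos by (simp add: v_def nrm_scale) (simp add: t_def)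
  have "complex_of_real (t\<^sup>2) \<odot> ((-1) \<odot> (u \<otimes> u)) = (-1) \<odot> (v \<otimes> v)"
    using u by (simp add: v_def scale_mult_left scale_mult_right scale_scale power2_eq_square)
  with norm_positive_scale[OF neg, of "t\<^sup>2"] have "norm_positive ((-1) \<odot> (v \<otimes> v))" by simp
  then obtain T where T: "T \<ge> 0"
    "\<And>b. b \<in> carrier A \<Longrightarrow> nrm A (complex_of_real T \<odot> b \<ominus> ((-1) \<odot> (v \<otimes> v)) \<otimes> b) \<le> T * nrm A b"
    by (auto simp: norm_positive_def)
  \<comment> \<open>Positivity of -v^2 bounds T b + v^2 b by T ||b||. Adding b - v^2 b leaves (1 +
    T) b, and T ||b|| cancels.\<close>
  have lower: "nrm A b \<le> nrm A (b \<ominus> v \<otimes> (v \<otimes> b))" if b: "b \<in> carrier A" for b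
  proof -
    let ?x = "b \<ominus> v \<otimes> (v \<otimes> b)" and ?y = "complex_of_real T \<odot> b \<ominus> ((-1) \<odot> (v \<otimes> v)) \<otimes> b"
    let ?z = "v \<otimes> (v \<otimes> b)"
    have "?x \<oplus> ?y = (b \<oplus> complex_of_real T \<odot> b) \<oplus> (1 \<odot> ?z \<oplus> (-1) \<odot> ?z)"
      using b v by (simp add: minus_eq_scale scale_mult_left scale_scale scale_one mult_assoc a_ac)
    also have "\<dots> = complex_of_real (1 + T) \<odot> b"
      using b v by (simp add: scale_add_left scale_one add_scale_minus_one)
    finally have eq: "?x \<oplus> ?y = complex_of_real (1 + T) \<odot> b" .
    have "(1 + T) * nrm A b = nrm A (?x \<oplus> ?y)"
      unfolding eq using b T(1) by (simp add: nrm_scale del: of_real_add)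
    also have "\<dots> \<le> nrm A ?x + T * nrm A b"
      using nrm_triangle[of ?x ?y] T(2)[OF b] b v by simp
    finally show ?thesis by (simp add: algebra_simps)
  qed
  have "(nrm A v)\<^sup>2 = nrm A (v \<otimes> v)" using cstar_identity[OF v(1)] v(2) by simp
  also have "\<dots> \<le> nrm A (v \<otimes> v \<ominus> v \<otimes> (v \<otimes> (v \<otimes> v)))" using lower[of "v \<otimes> v"] v by simp
  also have "\<dots> \<le> nrm A v / 2" using nrm_minus_cube_le[OF v(1) v(2) _ v(1)] nv by simp
  finally show False unfolding nv by (simp add: power2_eq_square)
qed

section \<open>Vanishing sums of hermitian squares\<close>

lemma sum_hermitian_squares_eq_zero:
  assumes x: "x \<in> carrier A" and y: "y \<in> carrier A"
    and sum: "x\<^sup>\<star> \<otimes> x \<oplus> y\<^sup>\<star> \<otimes> y = \<zero>"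
  shows "x = \<zero>" "y = \<zero>"
proof -
  define u v w where uvw: "u = y \<otimes> y\<^sup>\<star>" "v = x \<otimes> x\<^sup>\<star>" "w = x \<otimes> y\<^sup>\<star>"
  have cl: "u \<in> carrier A" "v \<in> carrier A" "w \<in> carrier A" using x y by (simp_all add: uvw)
  have sa: "u\<^sup>\<star> = u" "v\<^sup>\<star> = v" using x y by (simp_all add: uvw adj_mult adj_adj)
  have w': "w\<^sup>\<star> = y \<otimes> x\<^sup>\<star>" using x y by (simp add: uvw adj_mult adj_adj)
  have xx: "x\<^sup>\<star> \<otimes> x = (-1) \<odot> (y\<^sup>\<star> \<otimes> y)"
    using minus_equality[OF sum] x y by (simp add: neg_eq_scale)
  have yy: "y\<^sup>\<star> \<otimes> y = (-1) \<odot> (x\<^sup>\<star> \<otimes> x)"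
    unfolding xx using x y by (simp add: scale_scale scale_one)
  \<comment> \<open>Regrouping exposes x* x inside w* w, where it is replaced by -y* y; w w* is
    treated symmetrically.\<close>
  have "w\<^sup>\<star> \<otimes> w = y \<otimes> ((x\<^sup>\<star> \<otimes> x) \<otimes> y\<^sup>\<star>)"
    unfolding w' using x y by (simp add: uvw mult_assoc)
  then have w1: "w\<^sup>\<star> \<otimes> w = (-1) \<odot> (u \<otimes> u)"
    unfolding xx using x y by (simp add: uvw mult_assoc scale_mult_left scale_mult_right)
  have "w \<otimes> w\<^sup>\<star> = x \<otimes> ((y\<^sup>\<star> \<otimes> y) \<otimes> x\<^sup>\<star>)"
    unfolding w' using x y by (simp add: uvw mult_assoc)
  then have w2: "w \<otimes> w\<^sup>\<star> = (-1) \<odot> (v \<otimes> v)"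
    unfolding yy using x y by (simp add: uvw mult_assoc scale_mult_left scale_mult_right)
  \<comment> \<open>Twice the real part and minus twice the imaginary part of \<open>w\<close>. In
    the sum of their squares the terms \<open>P\<close> cancel.\<close>
  define \<alpha> \<beta> where ab: "\<alpha> = w \<oplus> w\<^sup>\<star>" "\<beta> = \<i> \<odot> (w \<ominus> w\<^sup>\<star>)"
  have ab_cl: "\<alpha> \<in> carrier A" "\<beta> \<in> carrier A" using cl by (simp_all add: ab)
  have ab_sa: "\<alpha>\<^sup>\<star> = \<alpha>" "\<beta>\<^sup>\<star> = \<beta>"
    using cl by (simp_all add: ab adj_add adj_adj adj_scale minus_eq_scale scale_add_right
        scale_scale a_ac)
  define P Q where PQ: "P = w \<otimes> w \<oplus> w\<^sup>\<star> \<otimes> w\<^sup>\<star>" "Q = w \<otimes> w\<^sup>\<star> \<oplus> w\<^sup>\<star> \<otimes> w"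
  have PQ_cl: "P \<in> carrier A" "Q \<in> carrier A" using cl by (simp_all add: PQ)
  have aa: "\<alpha> \<otimes> \<alpha> = P \<oplus> Q"
    using cl by (simp add: ab PQ mult_add_left mult_add_right a_ac)
  have bb: "\<beta> \<otimes> \<beta> = (-1) \<odot> P \<oplus> Q"
    using cl by (simp add: ab PQ minus_eq_scale mult_add_left mult_add_right scale_mult_left
        scale_mult_right scale_add_right scale_scale scale_one a_ac)
  have "\<alpha> \<otimes> \<alpha> \<oplus> \<beta> \<otimes> \<beta> = (P \<oplus> (-1) \<odot> P) \<oplus> (Q \<oplus> Q)"
    unfolding aa bb using PQ_cl by (simp add: a_ac)
  also have "\<dots> = 2 \<odot> Q" using PQ_cl scale_add_left[of Q 1 1] by (simp add: scale_one add_scale_minus_one)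
  finally have sum_ab: "\<alpha> \<otimes> \<alpha> \<oplus> \<beta> \<otimes> \<beta> = 2 \<odot> Q" .
  \<comment> \<open>Adding 2 v^2 cancels the -2 v^2 that comes from w w*, so -2 u^2 is a sum of
    squares of self-adjoint elements.\<close>
  have "complex_of_real 2 \<odot> (v \<otimes> v) \<oplus> (\<alpha> \<otimes> \<alpha> \<oplus> \<beta> \<otimes> \<beta>)
      = (2 \<odot> (v \<otimes> v) \<oplus> (-2) \<odot> (v \<otimes> v)) \<oplus> (-2) \<odot> (u \<otimes> u)"
    unfolding sum_ab PQ w1 w2 using cl by (simp add: scale_add_right scale_scale a_ac)
  also have "\<dots> = (-2) \<odot> (u \<otimes> u)" using cl by (simp flip: scale_add_left)
  finally have "norm_positive ((-2) \<odot> (u \<otimes> u))"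
    by (metis ab_cl ab_sa cl(2) norm_positive_add norm_positive_scale norm_positive_square sa(2)
        zero_le_numeral)
  from norm_positive_scale[OF this, of "1/2"] have "norm_positive ((-1) \<odot> (u \<otimes> u))"
    using cl by (simp add: scale_scale)
  then have "u = \<zero>" using norm_positive_minus_square_imp_zero cl(1) sa(1) by blast
  then have "(nrm A (y\<^sup>\<star>))\<^sup>2 = 0" using cstar_identity[of "y\<^sup>\<star>"] y by (simp add: uvw adj_adj)
  then show y0: "y = \<zero>" using y by (simp add: nrm_adj nrm_eq_zero_iff)
  have "(nrm A x)\<^sup>2 = 0" using cstar_identity[OF x] xx y0 by simp
  then show "x = \<zero>" using x by (simp add: nrm_eq_zero_iff)
qed

section \<open>The order on projections\<close>

lemma cstar_le_projection:
  assumes p: "projection A p" and q: "projection A q" and le: "p \<sqsubseteq> q"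
  shows "q \<otimes> p = p" "p \<otimes> q = p"
proof -
  have p': "p \<in> carrier A" "p\<^sup>\<star> = p" "p \<otimes> p = p" and q': "q \<in> carrier A" "q\<^sup>\<star> = q" "q \<otimes> q = q"
    using p q by (auto simp: projection_def)
  obtain c where c: "c \<in> carrier A" "q \<ominus> p = c\<^sup>\<star> \<otimes> c" using le by (auto simp: cstar_le_def)
  have pz: "p \<otimes> (p \<otimes> z) = p \<otimes> z" and qz: "q \<otimes> (q \<otimes> z) = q \<otimes> z" if "z \<in> carrier A" for z
    using p' q' that by (simp_all add: mult_assoc[symmetric])
  let ?x = "p \<ominus> q \<otimes> p" and ?y = "c \<otimes> p" and ?m = "p \<otimes> (q \<otimes> p)"
  have m: "?m \<in> carrier A" using p' q' by simp
  \<comment> \<open>Compressing q - p = c* c by p yields p q p - p, the negative of x* x computed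
    below.\<close>
  have "?y\<^sup>\<star> \<otimes> ?y = p \<otimes> ((c\<^sup>\<star> \<otimes> c) \<otimes> p)"
    using c(1) p' by (simp add: adj_mult mult_assoc)
  also have "\<dots> = ?m \<ominus> p"
    using p' q' by (simp add: c(2)[symmetric] mult_minus_left mult_minus_right)
  finally have y: "?y\<^sup>\<star> \<otimes> ?y = ?m \<ominus> p" .
  have "?x\<^sup>\<star> \<otimes> ?x = (p \<ominus> ?m) \<ominus> (?m \<ominus> ?m)"
    using p' q' by (simp add: adj_minus adj_mult mult_minus_left mult_minus_right mult_assoc pz qz)
  also have "\<dots> = p \<ominus> ?m" using p' m by (simp add: a_minus_def r_neg)
  finally have x: "?x\<^sup>\<star> \<otimes> ?x = p \<ominus> ?m" .
  have "(p \<ominus> ?m) \<oplus> (?m \<ominus> p) = \<zero>"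
  proof -
    have "(p \<ominus> ?m) \<oplus> (?m \<ominus> p) = (p \<oplus> (-1) \<odot> p) \<oplus> (?m \<oplus> (-1) \<odot> ?m)"
      using p'(1) q'(1) by (simp add: minus_eq_scale a_ac)
    then show ?thesis using p'(1) m by (simp add: add_scale_minus_one)
  qed
  then have "?x\<^sup>\<star> \<otimes> ?x \<oplus> ?y\<^sup>\<star> \<otimes> ?y = \<zero>" unfolding x y .
  then have "?x = \<zero>"
    by (rule sum_hermitian_squares_eq_zero(1)[rotated 2]) (use p' q' c in simp_all)
  then show qp: "q \<otimes> p = p" using p' q' eq_of_minus_eq_zero[of p "q \<otimes> p"] by simp
  then show "p \<otimes> q = p" using p' q' adj_mult[of q p] by simp
qed

text \<open>Here q - p is itself a projection, so it serves as the witness c.\<close>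

lemma cstar_le_of_absorb:
  assumes p: "projection A p" and q: "projection A q" and qp: "q \<otimes> p = p"
  shows "p \<sqsubseteq> q"
proof -
  have p': "p \<in> carrier A" "p\<^sup>\<star> = p" "p \<otimes> p = p" and q': "q \<in> carrier A" "q\<^sup>\<star> = q" "q \<otimes> q = q"
    using p q by (auto simp: projection_def)
  have pq: "p \<otimes> q = p" using p' q' adj_mult[of q p] qp by simp
  have "(q \<ominus> p)\<^sup>\<star> \<otimes> (q \<ominus> p) = (q \<ominus> p) \<ominus> (p \<ominus> p)"
    using p' q' by (simp add: adj_minus mult_minus_left mult_minus_right qp pq)
  also have "\<dots> = q \<ominus> p" using p' q' by (simp add: a_minus_def r_neg)
  finally show ?thesis using p' q' by (auto simp: cstar_le_def intro!: bexI[of _ "q \<ominus> p"])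
qed

section \<open>Finite sums and range projections\<close>

lemma mult_finsum_left:
  "\<lbrakk>finite F; f \<in> F \<rightarrow> carrier A; x \<in> carrier A\<rbrakk> \<Longrightarrow> x \<otimes> (\<Oplus>i\<in>F. f i) = (\<Oplus>i\<in>F. x \<otimes> f i)"
proof (induction F rule: finite_induct)
  case (insert i F)
  then have "f \<in> F \<rightarrow> carrier A" "f i \<in> carrier A" by auto
  with insert show ?case by (simp add: mult_add_right finsum_closed Pi_def)
qed simp

lemma mult_finsum_right:
  "\<lbrakk>finite F; f \<in> F \<rightarrow> carrier A; x \<in> carrier A\<rbrakk> \<Longrightarrow> (\<Oplus>i\<in>F. f i) \<otimes> x = (\<Oplus>i\<in>F. f i \<otimes> x)"
proof (induction F rule: finite_induct)
  case (insert i F)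
  then have "f \<in> F \<rightarrow> carrier A" "f i \<in> carrier A" by auto
  with insert show ?case by (simp add: mult_add_left finsum_closed Pi_def)
qed simp

lemma adj_finsum:
  "\<lbrakk>finite F; f \<in> F \<rightarrow> carrier A\<rbrakk> \<Longrightarrow> (\<Oplus>i\<in>F. f i)\<^sup>\<star> = (\<Oplus>i\<in>F. (f i)\<^sup>\<star>)"
proof (induction F rule: finite_induct)
  case (insert i F)
  then have "f \<in> F \<rightarrow> carrier A" "f i \<in> carrier A" by auto
  with insert show ?case by (simp add: adj_add finsum_closed Pi_def)
qed simp

lemma projection_range:
  "partial_isometry A s \<Longrightarrow> projection A (s \<otimes> s\<^sup>\<star>)"
  unfolding partial_isometry_def projection_def
  by (auto simp: adj_mult adj_adj simp flip: mult_assoc)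

text \<open>The range projections are mutually orthogonal, because s_e* s_f stands in the middle of
  their product.\<close>

lemma
  assumes fin: "finite F" and pi: "\<And>e. e \<in> F \<Longrightarrow> partial_isometry A (s e)"
    and orth: "\<And>e f. \<lbrakk>e \<in> F; f \<in> F; e \<noteq> f\<rbrakk> \<Longrightarrow> (s e)\<^sup>\<star> \<otimes> s f = \<zero>"
  shows sum_ranges_absorb: "\<And>f. f \<in> F \<Longrightarrow>
      (\<Oplus>e\<in>F. s e \<otimes> (s e)\<^sup>\<star>) \<otimes> (s f \<otimes> (s f)\<^sup>\<star>) = s f \<otimes> (s f)\<^sup>\<star>"
    and projection_sum_ranges: "projection A (\<Oplus>e\<in>F. s e \<otimes> (s e)\<^sup>\<star>)"
proof -
  define q where "q e = s e \<otimes> (s e)\<^sup>\<star>" for e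
  have s: "s e \<in> carrier A" if "e \<in> F" for e using pi[OF that] by (simp add: partial_isometry_def)
  have q: "projection A (q e)" if "e \<in> F" for e
    using projection_range[OF pi[OF that]] by (simp add: q_def)
  then have q': "q e \<in> carrier A" "(q e)\<^sup>\<star> = q e" "q e \<otimes> q e = q e" if "e \<in> F" for e
    using that by (auto simp: projection_def)
  have qq: "q e \<otimes> q f = (if f = e then q e else \<zero>)" if e: "e \<in> F" and f: "f \<in> F" for e f
  proof (cases "f = e")
    case False
    have "q e \<otimes> q f = s e \<otimes> (((s e)\<^sup>\<star> \<otimes> s f) \<otimes> (s f)\<^sup>\<star>)"
      using s[OF e] s[OF f] by (simp add: q_def mult_assoc)
    with False show ?thesis using orth[OF e f] s[OF e] s[OF f] by simp
  qed (use q'(3)[OF e] in simp)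
  have Q: "(\<Oplus>e\<in>F. q e) \<in> carrier A" using q'(1) by (intro finsum_closed) auto
  have absorb: "(\<Oplus>e\<in>F. q e) \<otimes> q f = q f" if f: "f \<in> F" for f
  proof -
    have "(\<Oplus>e\<in>F. q e) \<otimes> q f = (\<Oplus>e\<in>F. q e \<otimes> q f)"
      using fin q' f by (intro mult_finsum_right) auto
    also have "\<dots> = (\<Oplus>e\<in>F. if f = e then q e else \<zero>)"
      using qq f q'(1) by (intro finsum_cong') auto
    also have "\<dots> = q f" using fin q'(1) f by (intro finsum_singleton) auto
    finally show ?thesis .
  qed
  then show "\<And>f. f \<in> F \<Longrightarrow> (\<Oplus>e\<in>F. s e \<otimes> (s e)\<^sup>\<star>) \<otimes> (s f \<otimes> (s f)\<^sup>\<star>) = s f \<otimes> (s f)\<^sup>\<star>"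
    by (simp add: q_def)
  have "(\<Oplus>e\<in>F. q e) \<otimes> (\<Oplus>e\<in>F. q e) = (\<Oplus>f\<in>F. (\<Oplus>e\<in>F. q e) \<otimes> q f)"
    using fin q' Q by (intro mult_finsum_left) auto
  also have "\<dots> = (\<Oplus>f\<in>F. q f)" using absorb q'(1) by (intro finsum_cong') auto
  finally have idem: "(\<Oplus>e\<in>F. q e) \<otimes> (\<Oplus>e\<in>F. q e) = (\<Oplus>e\<in>F. q e)" .
  have "(\<Oplus>e\<in>F. q e)\<^sup>\<star> = (\<Oplus>e\<in>F. (q e)\<^sup>\<star>)" using fin q' by (intro adj_finsum) auto
  also have "\<dots> = (\<Oplus>e\<in>F. q e)" using q' by (intro finsum_cong') auto
  finally have "projection A (\<Oplus>e\<in>F. q e)" using idem Q by (simp add: projection_def)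
  then show "projection A (\<Oplus>e\<in>F. s e \<otimes> (s e)\<^sup>\<star>)" by (simp add: q_def)
qed

section \<open>Comparison of the two sets of relations\<close>

lemma cstar_le_refl: "x \<in> carrier A \<Longrightarrow> x \<sqsubseteq> x"
  unfolding cstar_le_def by (auto intro!: bexI[of _ \<zero>])

text \<open>Only (CK2) against (HR2a) and (HR2b) needs an argument. Let Q be the sum of the range
  projections of the edges leaving v. Under (CK2), p_v = Q absorbs each of them. Conversely, (HR2a)
  gives p_v Q = Q and (HR2b) gives p_v Q = p_v.\<close>

lemma cuntz_krieger_family_iff_hypergraph_family:
  assumes "fin_digraph \<Gamma>"
    and p: "\<And>v. v \<in> verts \<Gamma> \<Longrightarrow> p v \<in> carrier A"
  shows "cuntz_krieger_family \<Gamma> A p s \<longleftrightarrow> hypergraph_family (digraph_hypergraph \<Gamma>) A p s"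
    (is "?CK \<longleftrightarrow> ?HR")
proof -
  interpret fin_digraph \<Gamma> by fact
  let ?F = "\<lambda>v. {e \<in> arcs \<Gamma>. tail \<Gamma> e = v}"
  let ?Q = "\<lambda>v. \<Oplus>e\<in>?F v. s e \<otimes> (s e)\<^sup>\<star>"
  let ?common = "orthogonal_projections A (verts \<Gamma>) p \<and> (\<forall>e\<in>arcs \<Gamma>. partial_isometry A (s e)) \<and>
     (\<forall>e\<in>arcs \<Gamma>. \<forall>f\<in>arcs \<Gamma>. (s e)\<^sup>\<star> \<otimes> s f = (if e = f then p (head \<Gamma> e) else \<zero>))"
  \<comment> \<open>Membership of \<open>p\<close> in the carrier collapses these sums before either
    family is assumed.\<close>
  have single: "(\<Oplus>v\<in>{w}. p v) = p w" if "w \<in> verts \<Gamma>" for w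
    using p[OF that] by (simp add: finsum_insert)
  have sink: "hypergraph_sink (digraph_hypergraph \<Gamma>) v \<longleftrightarrow> graph_sink \<Gamma> v" for v
    by (auto simp: hypergraph_sink_def graph_sink_def digraph_hypergraph_def)
  have ck: "?CK \<longleftrightarrow> ?common \<and> (\<forall>v\<in>verts \<Gamma>. \<not> graph_sink \<Gamma> v \<longrightarrow> p v = ?Q v)"
    by (auto simp: cuntz_krieger_family_def)
  have F: "{e \<in> arcs \<Gamma>. v \<in> {tail \<Gamma> e}} = ?F v" for v by auto
  have H: "hverts (digraph_hypergraph \<Gamma>) = verts \<Gamma>" "hedges (digraph_hypergraph \<Gamma>) = arcs \<Gamma>"
    "hrange (digraph_hypergraph \<Gamma>) e = {head \<Gamma> e}" "hsource (digraph_hypergraph \<Gamma>) e = {tail \<Gamma> e}" for e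
    by (simp_all add: digraph_hypergraph_def)
  have range_sum: "(\<Oplus>v\<in>{head \<Gamma> e}. p v) = p (head \<Gamma> e)"
    and source_sum: "(\<Oplus>v\<in>{tail \<Gamma> e}. p v) = p (tail \<Gamma> e)" if "e \<in> arcs \<Gamma>" for e
    using that by (simp_all add: single)
  have hr: "?HR \<longleftrightarrow> ?common \<and> (\<forall>e\<in>arcs \<Gamma>. s e \<otimes> (s e)\<^sup>\<star> \<sqsubseteq> p (tail \<Gamma> e)) \<and>
      (\<forall>v\<in>verts \<Gamma>. \<not> graph_sink \<Gamma> v \<longrightarrow> p v \<sqsubseteq> ?Q v)"
    unfolding hypergraph_family_def sink F H
    by (simp only: range_sum source_sum conj_assoc cong: ball_cong)
  show ?thesis
  proof (cases ?common)
    case True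
    have proj_p: "projection A (p v)" if "v \<in> verts \<Gamma>" for v
      using True that by (auto simp: orthogonal_projections_def)
    have pi: "partial_isometry A (s e)" if "e \<in> arcs \<Gamma>" for e using True that by blast
    have fin: "finite (?F v)" for v by simp
    have Q: "projection A (?Q v)" for v
      using True by (intro projection_sum_ranges fin) auto
    have absorb: "?Q v \<otimes> (s e \<otimes> (s e)\<^sup>\<star>) = s e \<otimes> (s e)\<^sup>\<star>" if "e \<in> ?F v" for v e
      using True by (intro sum_ranges_absorb fin that) auto
    have "(\<forall>v\<in>verts \<Gamma>. \<not> graph_sink \<Gamma> v \<longrightarrow> p v = ?Q v) \<longleftrightarrow>
      (\<forall>e\<in>arcs \<Gamma>. s e \<otimes> (s e)\<^sup>\<star> \<sqsubseteq> p (tail \<Gamma> e)) \<and>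
      (\<forall>v\<in>verts \<Gamma>. \<not> graph_sink \<Gamma> v \<longrightarrow> p v \<sqsubseteq> ?Q v)" (is "?L \<longleftrightarrow> ?R")
    proof
      assume L: ?L
      show ?R
      proof (intro conjI ballI impI)
        fix e assume e: "e \<in> arcs \<Gamma>"
        \<comment> \<open>The edge itself keeps its source from being a sink, so (CK2) is available
          there.\<close>
        then have "\<not> graph_sink \<Gamma> (tail \<Gamma> e)" by (auto simp: graph_sink_def)
        with L e have "p (tail \<Gamma> e) = ?Q (tail \<Gamma> e)" by simp
        then show "s e \<otimes> (s e)\<^sup>\<star> \<sqsubseteq> p (tail \<Gamma> e)"
          using cstar_le_of_absorb[OF projection_range[OF pi[OF e]] Q] absorb[of e "tail \<Gamma> e"] e
          by simp
      next
        fix v assume v: "v \<in> verts \<Gamma>" "\<not> graph_sink \<Gamma> v"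
        then have "?Q v = p v" using L by simp
        then show "p v \<sqsubseteq> ?Q v" using cstar_le_refl[OF p[OF v(1)]] by simp
      qed
    next
      assume R: ?R
      show ?L
      proof (intro ballI impI)
        fix v assume v: "v \<in> verts \<Gamma>" "\<not> graph_sink \<Gamma> v"
        have q: "s e \<otimes> (s e)\<^sup>\<star> \<in> carrier A" if "e \<in> ?F v" for e
          using pi[of e] that by (auto simp: partial_isometry_def)
        have pq: "p v \<otimes> (s e \<otimes> (s e)\<^sup>\<star>) = s e \<otimes> (s e)\<^sup>\<star>" if "e \<in> ?F v" for e
          using R that pi[of e] proj_p[OF v(1)] projection_range
          by (intro cstar_le_projection(1)) auto
        have "p v \<otimes> ?Q v = (\<Oplus>e\<in>?F v. p v \<otimes> (s e \<otimes> (s e)\<^sup>\<star>))"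
          using p[OF v(1)] q by (intro mult_finsum_left fin) auto
        also have "\<dots> = ?Q v" using q pq by (intro finsum_cong') auto
        finally have "p v \<otimes> ?Q v = ?Q v" .
        moreover have "p v \<otimes> ?Q v = p v"
          using cstar_le_projection(2)[OF proj_p[OF v(1)] Q] R v by blast
        ultimately show "p v = ?Q v" by simp
      qed
    qed
    then show ?thesis unfolding ck hr by blast
  next
    case False
    then show ?thesis unfolding ck hr by blast
  qed
qed

end

section \<open>Equality of the universal algebras\<close>

theorem proposition3p4:
  fixes \<Gamma> :: "('v, 'e) pre_digraph"
  assumes "fin_digraph \<Gamma>"
  shows "cstar_isomorphic (graph_cstar_algebra \<Gamma>)
           (hypergraph_cstar_algebra (digraph_hypergraph \<Gamma>))"
proof -
  let ?G = "verts \<Gamma> <+> arcs \<Gamma>"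
  let ?CK = "\<lambda>(A :: ('v + 'e) rep_elem cstar) f. cuntz_krieger_family \<Gamma> A (\<lambda>v. f (Inl v)) (\<lambda>e. f (Inr e))"
  let ?HR = "\<lambda>(A :: ('v + 'e) rep_elem cstar) f.
    hypergraph_family (digraph_hypergraph \<Gamma>) A (\<lambda>v. f (Inl v)) (\<lambda>e. f (Inr e))"
  have "?CK B f \<longleftrightarrow> ?HR B f" if "cstar_algebra B" "f \<in> ?G \<rightarrow> carrier B" for B f
    using that(2)
    by (intro cstar_algebra.cuntz_krieger_family_iff_hypergraph_family[OF that(1) assms]) auto
  then have reps_eq: "reps ?G ?CK = reps ?G ?HR"
    unfolding reps_def by auto
  have verts_edges: "hverts (digraph_hypergraph \<Gamma>) = verts \<Gamma>" "hedges (digraph_hypergraph \<Gamma>) = arcs \<Gamma>"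
    by (simp_all add: digraph_hypergraph_def)
  \<comment> \<open>The relations enter \<open>universal_cstar\<close> only through
    \<open>reps\<close>, so the two algebras are equal and the identity is an isomorphism.\<close>
  have "graph_cstar_algebra \<Gamma> = hypergraph_cstar_algebra (digraph_hypergraph \<Gamma>)"
    unfolding graph_cstar_algebra_def hypergraph_cstar_algebra_def
    by (simp add: universal_cstar_def reps_eq verts_edges)
  moreover have "cstar_isomorphic B B" for B :: "('x, 'm) cstar_scheme"
    unfolding cstar_isomorphic_def by (rule bexI[of _ id]) (auto simp: star_hom_def)
  ultimately show ?thesis by simp
qed

end
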